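(* Let $L$ be a nilpotent symplectic alternating algebra of dimension $2n\geq 8$ given by some nilpotent presentation $$\mathcal{P}:\ \ (x_{i}y_{j},y_{k})=\alpha_{ijk},\quad (y_{i}y_{j},y_{k})=\beta_{ijk},\qquad 1\leq i<j<k\leq n.$$ Then $L$ is of maximal class if and only if $x_{n-2}y_{n-1},\ x_{n-3}y_{n-2},\ \ldots,\ x_{2}y_{3}$ are all non-zero and $x_{1}y_{2},\ y_{1}y_{2}$ are linearly independent.
   Context: A symplectic alternating algebra over a field $F$ is a triple $(L,(\ ,\ ),\cdot)$ where $L$ is a finite-dimensional vector space over $F$ with a non-degenerate alternating bilinear form $(\ ,\ )$ and $\cdot$ is a bilinear alternating operation on $L$ (so $u\cdot u=0$ for all $u$) such that $(u\cdot v,w)=(v\cdot w,u)$ for all $u,v,w\in L$. Then $\dim L$ is even. The product $u\cdot v$ is also written $uv$. For subspaces $U,V$, $UV$ is the subspace spanned by all products $u\cdot v$ with $u\in U,v\in V$. An ideal is a subspace $I$ with $IL\leq I$. $L$ is nilpotent if there is a chain of ideals $\{0\}=J_{0}\leq\cdots\leq J_{m}=L$ with $J_{s}L\leq J_{s-1}$ for $s=1,\ldots,m$; the smallest possible $m$ is the nilpotence class. A nilpotent symplectic alternating algebra of dimension $2n\geq 8$ has class at most $2n-3$; it is of maximal class if its class equals $2n-3$. A standard basis is a basis $x_{1},y_{1},\ldots,x_{n},y_{n}$ with $(x_{i},x_{j})=(y_{i},y_{j})=0$ and $(x_{i},y_{j})=\delta_{ij}$. A nilpotent presentation $\mathcal{P}$,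 with $\alpha_{ijk},\beta_{ijk}\in F$, describes the symplectic alternating algebra with standard basis $x_{1},y_{1},\ldots,x_{n},y_{n}$ for which the alternating ternary form $(u\cdot v,w)$ takes the listed values and vanishes on every triple of basis elements that is not, up to permutation, one of the triples $(x_{i},y_{j},y_{k})$ or $(y_{i},y_{j},y_{k})$ with $1\leq i<j<k\leq n$. Every algebra given by such a presentation is nilpotent. *)

theory Defs
  imports Complex_Main "HOL-Library.Multiset"
begin

text \<open>
  The algebra \<open>L\<close> is the whole type \<open>'b\<close>, with scalar multiplication \<open>scale\<close> over the
  field \<open>'a\<close>.
\<close>

locale symplectic_alternating_algebra = vector_space scale
  for scale :: "'a::field \<Rightarrow> 'b::ab_group_add \<Rightarrow> 'b" +
  fixes form :: "'b \<Rightarrow> 'b \<Rightarrow> 'a"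
    and mult :: "'b \<Rightarrow> 'b \<Rightarrow> 'b"  (infixl "\<cdot>" 70)
  assumes finite_dimensional: "\<exists>B. finite_dimensional_vector_space scale B"
    and form_linear_left: "Vector_Spaces.linear scale (*) (\<lambda>u. form u v)"
    and form_linear_right: "Vector_Spaces.linear scale (*) (\<lambda>v. form u v)"
    and form_alternating: "form u u = 0"
    and form_nondegenerate: "(\<And>v. form u v = 0) \<Longrightarrow> u = 0"
    and mult_linear_left: "Vector_Spaces.linear scale scale (\<lambda>u. u \<cdot> v)"
    and mult_linear_right: "Vector_Spaces.linear scale scale (\<lambda>v. u \<cdot> v)"
    and mult_alternating: "u \<cdot> u = 0"
    and form_mult_cyclic: "form (u \<cdot> v) w = form (v \<cdot> w) u"
begin

definition subspace_prod :: "'b set \<Rightarrow> 'b set \<Rightarrow> 'b set" where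
  "subspace_prod U V = span {u \<cdot> v |u v. u \<in> U \<and> v \<in> V}"

definition is_ideal :: "'b set \<Rightarrow> bool" where
  "is_ideal I \<longleftrightarrow> subspace I \<and> subspace_prod I UNIV \<subseteq> I"

definition central_chain :: "nat \<Rightarrow> (nat \<Rightarrow> 'b set) \<Rightarrow> bool" where
  "central_chain m J \<longleftrightarrow>
     (\<forall>s\<le>m. is_ideal (J s)) \<and> J 0 = {0} \<and> J m = UNIV \<and>
     (\<forall>s\<in>{1..m}. J (s - 1) \<subseteq> J s \<and> subspace_prod (J s) UNIV \<subseteq> J (s - 1))"

definition nilpotent :: bool where
  "nilpotent \<longleftrightarrow> (\<exists>m J. central_chain m J)"

text \<open>Meaningful only for nilpotent algebras.\<close>

definition nilpotence_class :: nat where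
  "nilpotence_class = (LEAST m. \<exists>J. central_chain m J)"

text \<open>
  With \<open>dim UNIV = 2n\<close> this is class \<open>2n - 3\<close>; the notion is intended for dimension at least 8.
\<close>

definition maximal_class :: bool where
  "maximal_class \<longleftrightarrow> nilpotent \<and> nilpotence_class = dim UNIV - 3"

text \<open>
  Families are indexed from 1; the values of \<open>x\<close> and \<open>y\<close> outside \<open>{1..n}\<close> are irrelevant.
  The cardinality condition says that the \<open>2n\<close> listed vectors are distinct.
\<close>

definition standard_basis :: "nat \<Rightarrow> (nat \<Rightarrow> 'b) \<Rightarrow> (nat \<Rightarrow> 'b) \<Rightarrow> bool" where
  "standard_basis n x y \<longleftrightarrow>
     card (x ` {1..n} \<union> y ` {1..n}) = 2 * n \<and>
     independent (x ` {1..n} \<union> y ` {1..n}) \<and>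
     span (x ` {1..n} \<union> y ` {1..n}) = UNIV \<and>
     (\<forall>i\<in>{1..n}. \<forall>j\<in>{1..n}.
        form (x i) (x j) = 0 \<and> form (y i) (y j) = 0 \<and>
        form (x i) (y j) = (if i = j then 1 else 0))"

text \<open>Equality of multisets expresses that two triples agree up to permutation.\<close>

definition nilpotent_presentation ::
    "nat \<Rightarrow> (nat \<Rightarrow> 'b) \<Rightarrow> (nat \<Rightarrow> 'b) \<Rightarrow>
     (nat \<Rightarrow> nat \<Rightarrow> nat \<Rightarrow> 'a) \<Rightarrow> (nat \<Rightarrow> nat \<Rightarrow> nat \<Rightarrow> 'a) \<Rightarrow> bool" where
  "nilpotent_presentation n x y \<alpha> \<beta> \<longleftrightarrow>
     standard_basis n x y \<and>
     (\<forall>i j k. 1 \<le> i \<and> i < j \<and> j < k \<and> k \<le> n \<longrightarrow>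
        form (x i \<cdot> y j) (y k) = \<alpha> i j k \<and> form (y i \<cdot> y j) (y k) = \<beta> i j k) \<and>
     (\<forall>u \<in> x ` {1..n} \<union> y ` {1..n}. \<forall>v \<in> x ` {1..n} \<union> y ` {1..n}.
      \<forall>w \<in> x ` {1..n} \<union> y ` {1..n}.
        (\<nexists>i j k. 1 \<le> i \<and> i < j \<and> j < k \<and> k \<le> n \<and>
           ({#u, v, w#} = {#x i, y j, y k#} \<or> {#u, v, w#} = {#y i, y j, y k#})) \<longrightarrow>
        form (u \<cdot> v) w = 0)"

text \<open>
  Independence of the family \<open>(u, v)\<close>: independence of the set \<open>{u, v}\<close> alone would admit
  \<open>u = v \<noteq> 0\<close>.
\<close>

definition lin_independent_pair :: "'b \<Rightarrow> 'b \<Rightarrow> bool" where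
  "lin_independent_pair u v \<longleftrightarrow> u \<noteq> v \<and> independent {u, v}"

end

end

theory Submission imports Defs begin

text \<open>
  Write \<open>e\<^sub>1, \<dots>, e\<^sub>2\<^sub>n\<close> for \<open>x\<^sub>n, \<dots>, x\<^sub>1, y\<^sub>1, \<dots>, y\<^sub>n\<close>. Then \<open>e\<^sub>p\<close> is paired only with
  \<open>e\<^sub>q\<close>, \<open>p + q = 2n + 1\<close>, and the presentation says exactly that \<open>(e\<^sub>p e\<^sub>q, e\<^sub>r) = 0\<close> as soon as two of
  the indices have sum at most \<open>2n + 1\<close>. Let \<open>A\<^sub>t\<close> be the orthogonal complement of
  \<open>e\<^sub>1, \<dots>, e\<^sub>t\<close>. By cyclicity, \<open>u L \<subseteq> A\<^sub>r\<close> if and only if \<open>u\<close> annihilates \<open>e\<^sub>1, \<dots>, e\<^sub>r\<close>. Hence the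
  lower central series descends at least as fast as
  \<open>A\<^sub>0, A\<^sub>2, A\<^sub>3, \<dots>, A\<^bsub>n-1\<^esub>, A\<^bsub>n+1\<^esub>, \<dots>, A\<^bsub>2n-2\<^esub>, A\<^bsub>2n\<^esub> = 0\<close>, and only the products \<open>e\<^sub>p e\<^sub>q\<close> with
  \<open>p + q = 2n + 2\<close> decide whether a step descends faster. When the stated conditions hold, no
  step does; when one of them fails, a term of this chain can be skipped.
\<close>

context symplectic_alternating_algebra
begin

section \<open>Bilinearity, skew symmetry and independent pairs\<close>

lemma form_add_left: "form (u + v) w = form u w + form v w"
  and form_scale_left: "form (scale c u) w = c * form u w"
  and form_add_right: "form w (u + v) = form w u + form w v"
  and form_scale_right: "form w (scale c u) = c * form w u"
  using form_linear_left[of w] form_linear_right[of w]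
  by (simp_all add: Vector_Spaces.linear_def module_hom_iff)

lemma mult_add_left: "(u + v) \<cdot> w = u \<cdot> w + v \<cdot> w"
  and mult_scale_left: "scale c u \<cdot> w = scale c (u \<cdot> w)"
  and mult_add_right: "w \<cdot> (u + v) = w \<cdot> u + w \<cdot> v"
  and mult_scale_right: "w \<cdot> scale c u = scale c (w \<cdot> u)"
  using mult_linear_left[of w] mult_linear_right[of w]
  by (simp_all add: Vector_Spaces.linear_def module_hom_iff)

lemma form_zero_left [simp]: "form 0 w = 0"
  and form_zero_right [simp]: "form w 0 = 0"
  and mult_zero_right [simp]: "w \<cdot> 0 = 0"
  using form_scale_left[of 0 0 w] form_scale_right[of w 0 0] mult_scale_right[of w 0 0] by auto

lemma form_skew: "form v u = - form u v"
  using form_alternating[of "u + v"] form_alternating[of u] form_alternating[of v]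
  by (simp add: form_add_left form_add_right eq_neg_iff_add_eq_0 add.commute)

lemma mult_skew: "v \<cdot> u = - (u \<cdot> v)"
  using mult_alternating[of "u + v"] mult_alternating[of u] mult_alternating[of v]
  by (simp add: mult_add_left mult_add_right eq_neg_iff_add_eq_0 add.commute)

lemma subspace_orthogonal: "subspace {v. form u v = 0}"
  by (auto simp: subspace_def form_add_right form_scale_right)

lemma lin_independent_pair_iff:
  "lin_independent_pair u v \<longleftrightarrow> (\<forall>a b. scale a u + scale b v = 0 \<longrightarrow> a = 0 \<and> b = 0)"
proof
  assume *: "lin_independent_pair u v"
  then have "u \<noteq> v" and ind: "independent {u, v}" by (auto simp: lin_independent_pair_def)
  then have uv: "u \<notin> span {v}" "v \<noteq> 0"
    using independent_insert[of u "{v}"] dependent_zero[of "{u, v}"] by (simp_all split: if_splits)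
  show "\<forall>a b. scale a u + scale b v = 0 \<longrightarrow> a = 0 \<and> b = 0"
  proof (intro allI impI)
    fix a b assume eq: "scale a u + scale b v = 0"
    have "a = 0"
    proof (rule ccontr)
      assume "a \<noteq> 0"
      have "scale a u = scale (- b) v" using eq by (simp add: eq_neg_iff_add_eq_0)
      then have "scale (inverse a) (scale a u) = scale (inverse a) (scale (- b) v)" by simp
      then have "u = scale (inverse a * - b) v" using \<open>a \<noteq> 0\<close> by simp
      then show False using uv by (metis span_base span_scale singletonI)
    qed
    then show "a = 0 \<and> b = 0" using eq uv by simp
  qed
next
  assume *: "\<forall>a b. scale a u + scale b v = 0 \<longrightarrow> a = 0 \<and> b = 0"
  have "u \<notin> span {v}"
  proof
    assume "u \<in> span {v}"
    then obtain k where "u = scale k v" by (auto simp: span_singleton)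
    then have "scale 1 u + scale (- k) v = 0" by simp
    then show False using * by (metis one_neq_zero)
  qed
  moreover have "v \<noteq> 0" using *[rule_format, of 0 1] by auto
  moreover have "u \<noteq> v" using *[rule_format, of 1 "- 1"] by auto
  ultimately show "lin_independent_pair u v"
    using independent_insert[of u "{v}"] by (simp add: lin_independent_pair_def)
qed

section \<open>The lower central series and the nilpotence class\<close>

fun lower_central :: "nat \<Rightarrow> 'b set" where
  "lower_central 0 = UNIV"
| "lower_central (Suc d) = subspace_prod (lower_central d) UNIV"

lemma mult_in_subspace_prod: "u \<in> U \<Longrightarrow> v \<in> V \<Longrightarrow> u \<cdot> v \<in> subspace_prod U V"
  unfolding subspace_prod_def by (rule span_base) auto

lemma subspace_prod_subset_iff:
  assumes "subspace V"
  shows "subspace_prod U UNIV \<subseteq> V \<longleftrightarrow> (\<forall>u\<in>U. \<forall>v. u \<cdot> v \<in> V)"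
proof
  assume *: "\<forall>u\<in>U. \<forall>v. u \<cdot> v \<in> V"
  show "subspace_prod U UNIV \<subseteq> V"
    unfolding subspace_prod_def by (rule span_minimal[OF _ assms]) (use * in auto)
qed (auto intro: mult_in_subspace_prod)

lemma subspace_prod_mono: "U \<subseteq> U' \<Longrightarrow> subspace_prod U V \<subseteq> subspace_prod U' V"
  unfolding subspace_prod_def by (rule span_mono) auto

lemma subspace_lower_central: "subspace (lower_central d)"
  by (cases d) (auto simp: subspace_prod_def)

lemma lower_central_Suc_subset: "lower_central (Suc d) \<subseteq> lower_central d"
proof (induction d)
  case (Suc d)
  then show ?case by (auto dest: subspace_prod_mono)
qed auto

lemma lower_central_antimono: "d \<le> d' \<Longrightarrow> lower_central d' \<subseteq> lower_central d"
  by (rule lift_Suc_antimono_le[of lower_central, OF lower_central_Suc_subset])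

text \<open>The lower central series descends fastest: by induction its term \<open>d\<close> lies
  in \<open>J (m - d)\<close> for every chain \<open>J\<close>. Conversely, the series read
  backwards is itself a chain.\<close>

lemma central_chain_iff: "(\<exists>J. central_chain m J) \<longleftrightarrow> lower_central m = {0}"
proof
  assume "\<exists>J. central_chain m J"
  then obtain J where J: "central_chain m J" by blast
  have sub: "lower_central d \<subseteq> J (m - d)" if "d \<le> m" for d
    using that
  proof (induction d)
    case 0
    then show ?case using J by (auto simp: central_chain_def)
  next
    case (Suc d)
    have "m - d \<in> {1..m}" using Suc.prems by auto
    then have "subspace_prod (J (m - d)) UNIV \<subseteq> J (m - d - 1)"
      using J unfolding central_chain_def by blast
    moreover have "lower_central (Suc d) \<subseteq> subspace_prod (J (m - d)) UNIV"
      using Suc by (simp add: subspace_prod_mono)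
    ultimately show ?case by simp
  qed
  show "lower_central m = {0}"
    using sub[of m] J subspace_0[OF subspace_lower_central, of m]
    by (auto simp: central_chain_def)
next
  assume *: "lower_central m = {0}"
  have "central_chain m (\<lambda>s. lower_central (m - s))"
    unfolding central_chain_def is_ideal_def
  proof (intro conjI allI impI ballI)
    fix s assume s: "s \<in> {1..m}"
    then have "m - (s - 1) = Suc (m - s)" by auto
    then show "lower_central (m - (s - 1)) \<subseteq> lower_central (m - s)"
      and "subspace_prod (lower_central (m - s)) UNIV \<subseteq> lower_central (m - (s - 1))"
      using lower_central_Suc_subset by auto
  qed (use * subspace_lower_central lower_central_Suc_subset in auto)
  then show "\<exists>J. central_chain m J" by blast
qed

lemma nilpotence_class_eq: "nilpotence_class = (LEAST m. lower_central m = {0})"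
  by (simp add: nilpotence_class_def central_chain_iff)

end

section \<open>Flag bases and their orthogonal complements\<close>

locale flag_basis =
  symplectic_alternating_algebra scale form mult
  for scale :: "'a::field \<Rightarrow> 'b::ab_group_add \<Rightarrow> 'b"
    and form :: "'b \<Rightarrow> 'b \<Rightarrow> 'a"
    and mult :: "'b \<Rightarrow> 'b \<Rightarrow> 'b"  (infixl "\<cdot>" 70) +
  fixes n :: nat and e :: "nat \<Rightarrow> 'b"
  assumes n_ge: "n \<ge> 4"
    and span_e: "span (e ` {1..2 * n}) = UNIV"
    and form_e_eq_0_iff:
      "p \<in> {1..2 * n} \<Longrightarrow> q \<in> {1..2 * n} \<Longrightarrow> form (e p) (e q) = 0 \<longleftrightarrow> p + q \<noteq> 2 * n + 1"
    and triple_eq_0: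
      "p \<in> {1..2 * n} \<Longrightarrow> q \<in> {1..2 * n} \<Longrightarrow> r \<in> {1..2 * n} \<Longrightarrow> p + q \<le> 2 * n + 1 \<Longrightarrow>
        form (e p \<cdot> e q) (e r) = 0"
begin

text \<open>The space \<open>A\<^sub>t\<close> of the overview. As \<open>e p\<close> pairs
  nontrivially only with \<open>e (2 * n + 1 - p)\<close>, it is also the span of
  \<open>e 1, ..., e (2 * n - t)\<close>.\<close>

definition annihilator :: "nat \<Rightarrow> 'b set" where
  "annihilator t = {u. \<forall>r\<in>{1..t}. form u (e r) = 0}"

lemma subspace_annihilator: "subspace (annihilator t)"
  by (auto simp: subspace_def annihilator_def form_add_left form_scale_left)

lemma annihilator_0 [simp]: "annihilator 0 = UNIV"
  by (simp add: annihilator_def)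

lemma annihilator_antimono: "s \<le> t \<Longrightarrow> annihilator t \<subseteq> annihilator s"
  by (auto simp: annihilator_def)

lemma annihilator_SucI: "u \<in> annihilator t \<Longrightarrow> form u (e (Suc t)) = 0 \<Longrightarrow> u \<in> annihilator (Suc t)"
  by (auto simp: annihilator_def le_Suc_eq)

lemma eq_0_if_orthogonal:
  assumes "\<And>p. p \<in> {1..2 * n} \<Longrightarrow> form u (e p) = 0"
  shows "u = 0"
proof (rule form_nondegenerate)
  have "span (e ` {1..2 * n}) \<subseteq> {v. form u v = 0}"
    by (rule span_minimal[OF _ subspace_orthogonal]) (use assms in auto)
  then show "form u v = 0" for v using span_e by auto
qed

lemma annihilator_top: "annihilator (2 * n) = {0}"
  using eq_0_if_orthogonal by (auto simp: annihilator_def)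

lemma e_mult_e_eq_0:
  assumes "p \<in> {1..2 * n}" "q \<in> {1..2 * n}" "p + q \<le> 2 * n + 1"
  shows "e p \<cdot> e q = 0"
  using assms by (intro eq_0_if_orthogonal triple_eq_0)

text \<open>Cyclicity brings any two of the three factors together, so the index bound also governs
  \<open>p\<close> and \<open>r\<close>, and a repeated factor produces a square.\<close>

lemma triple_nonzeroD:
  assumes "p \<in> {1..2 * n}" "q \<in> {1..2 * n}" "r \<in> {1..2 * n}" "form (e p \<cdot> e q) (e r) \<noteq> 0"
  shows "p + r > 2 * n + 1" "r \<noteq> p" "r \<noteq> q"
proof -
  have cyc: "form (e p \<cdot> e q) (e r) = form (e r \<cdot> e p) (e q)"
    "form (e p \<cdot> e q) (e r) = form (e q \<cdot> e r) (e p)"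
    by (metis form_mult_cyclic)+
  show "p + r > 2 * n + 1"
    using triple_eq_0[of r p q] assms cyc by (metis add.commute not_le)
  show "r \<noteq> p" "r \<noteq> q" using assms cyc mult_alternating by auto
qed

text \<open>Peels off one basis vector: \<open>e (2 * n - t)\<close> is the partner of
  \<open>e (Suc t)\<close> and is orthogonal to \<open>e 1, ..., e t\<close>, so a multiple of it
  corrects the pairing with \<open>e (Suc t)\<close>.\<close>

lemma annihilator_leading:
  assumes u: "u \<in> annihilator t" and t: "t < 2 * n"
  obtains c w where "u = scale c (e (2 * n - t)) + w" "w \<in> annihilator (Suc t)"
    "c = 0 \<Longrightarrow> u \<in> annihilator (Suc t)"
proof -
  define g where "g = form (e (2 * n - t)) (e (Suc t))"
  define c where "c = form u (e (Suc t)) / g"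
  have g: "g \<noteq> 0" using t by (auto simp: g_def form_e_eq_0_iff)
  define w where "w = u + scale (- c) (e (2 * n - t))"
  have "w \<in> annihilator t"
    using u t by (auto simp: annihilator_def w_def form_add_left form_scale_left form_e_eq_0_iff
        simp del: scale_minus_left)
  moreover have "form w (e (Suc t)) = 0"
    using g by (simp add: w_def form_add_left form_scale_left c_def g_def[symmetric]
        del: scale_minus_left)
  ultimately have w: "w \<in> annihilator (Suc t)" by (rule annihilator_SucI)
  have "u = scale c (e (2 * n - t)) + w" by (simp add: w_def)
  with w that show ?thesis by auto
qed

text \<open>Downward induction on \<open>t\<close>. The vector peeled off is
  \<open>e (2 * n - t)\<close>, and \<open>k + (2 * n - t)\<close> is at most
  \<open>2 * n + 1\<close>, so its product with \<open>e k\<close> vanishes.\<close>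

lemma e_mult_annihilator:
  assumes "u \<in> annihilator t" "t \<le> 2 * n" "1 \<le> k" "k \<le> t + 1" "k \<le> 2 * n"
  shows "e k \<cdot> u = 0"
  using assms(2,1,4)
proof (induction t arbitrary: u rule: inc_induct)
  case base
  then show ?case by (simp add: annihilator_top)
next
  case (step t)
  from annihilator_leading[OF step.prems(1) step.hyps(2)]
  obtain c w where u: "u = scale c (e (2 * n - t)) + w" and w: "w \<in> annihilator (Suc t)"
    by metis
  have "e k \<cdot> e (2 * n - t) = 0"
    by (rule e_mult_e_eq_0) (use step assms in auto)
  moreover have "e k \<cdot> w = 0"
    using w step by auto
  ultimately show ?case by (simp add: u mult_add_right mult_scale_right)
qed

lemma mult_in_annihilator_iff:
  assumes "r \<le> 2 * n"
  shows "(\<forall>v. u \<cdot> v \<in> annihilator r) \<longleftrightarrow> (\<forall>k\<in>{1..r}. e k \<cdot> u = 0)"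
proof -
  have "form (u \<cdot> v) (e k) = form (e k \<cdot> u) v" for v k
    by (metis form_mult_cyclic)
  then show ?thesis
    unfolding annihilator_def using form_nondegenerate by fastforce
qed

section \<open>Descent of the lower central series through the flag\<close>

declare lower_central.simps(2) [simp del]

lemma lower_central_Suc_subset_iff:
  assumes "r \<le> 2 * n"
  shows "lower_central (Suc d) \<subseteq> annihilator r \<longleftrightarrow>
    (\<forall>u\<in>lower_central d. \<forall>k\<in>{1..r}. e k \<cdot> u = 0)"
  using mult_in_annihilator_iff[OF assms]
  by (simp add: subspace_prod_subset_iff[OF subspace_annihilator] lower_central.simps(2))

lemma lower_central_step:
  assumes "lower_central d \<subseteq> annihilator t" "t < 2 * n"
  shows "lower_central (Suc d) \<subseteq> annihilator (Suc t)"
  using assms by (subst lower_central_Suc_subset_iff) (auto intro!: e_mult_annihilator[of _ t])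

lemma lower_central_steps:
  assumes "lower_central d \<subseteq> annihilator t" "t + j \<le> 2 * n"
  shows "lower_central (d + j) \<subseteq> annihilator (t + j)"
  using assms(2)
proof (induction j)
  case (Suc j)
  then show ?case using lower_central_step[of "d + j" "t + j"] by simp
qed (use assms in simp)

text \<open>All other products \<open>e\<^sub>k e\<^sub>p\<close> with \<open>k \<le> t + 2\<close> and \<open>p \<le> 2n - t\<close> vanish in any case.\<close>

lemma lower_central_skip:
  assumes "lower_central d \<subseteq> annihilator t" "t + 2 \<le> 2 * n" "e (t + 2) \<cdot> e (2 * n - t) = 0"
  shows "lower_central (Suc d) \<subseteq> annihilator (t + 2)"
proof (subst lower_central_Suc_subset_iff, goal_cases)
  case 2
  show ?case
  proof (intro ballI)
    fix u k assume "u \<in> lower_central d" and k: "k \<in> {1..t + 2}"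
    then have u: "u \<in> annihilator t" using assms by auto
    show "e k \<cdot> u = 0"
    proof (cases "k = t + 2")
      case True
      from annihilator_leading[OF u] assms(2)
      obtain c w where uw: "u = scale c (e (2 * n - t)) + w" and w: "w \<in> annihilator (Suc t)"
        by (metis add_2_eq_Suc' less_eq_Suc_le Suc_leD)
      have "e k \<cdot> w = 0" by (rule e_mult_annihilator[OF w]) (use k assms in auto)
      then show ?thesis using True assms by (simp add: uw mult_add_right mult_scale_right)
    next
      case False
      then show ?thesis using k assms by (intro e_mult_annihilator[OF u]) auto
    qed
  qed
qed (use assms in simp)

text \<open>A nonzero pairing with \<open>e p\<close> would need \<open>2 + p > 2 * n + 1\<close>,
  hence \<open>p = 2 * n\<close>, which repeats a factor. This makes the double steps at both ends
  of the flag free.\<close>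

lemma e_2_mult: "e 2 \<cdot> e (2 * n) = 0"
proof (rule eq_0_if_orthogonal, rule ccontr)
  fix p assume p: "p \<in> {1..2 * n}" "form (e 2 \<cdot> e (2 * n)) (e p) \<noteq> 0"
  then show False using triple_nonzeroD[of 2 "2 * n" p] n_ge by auto
qed

lemma lower_central_1: "lower_central 1 \<subseteq> annihilator 2"
  using lower_central_skip[of 0 0] e_2_mult n_ge by (simp add: numeral_2_eq_2)

lemma lower_central_upper:
  assumes "1 \<le> d" "d < 2 * n"
  shows "lower_central d \<subseteq> annihilator (d + 1)"
  using lower_central_steps[OF lower_central_1, of "d - 1"] assms by simp

text \<open>The product that decides this double step is the square of
  \<open>e (n + 1)\<close>.\<close>

lemma lower_central_middle:
  assumes "lower_central d \<subseteq> annihilator (n - 1)"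
  shows "lower_central (Suc d) \<subseteq> annihilator (n + 1)"
  using lower_central_skip[OF assms] mult_alternating n_ge
  by (simp add: numeral_2_eq_2 Suc_diff_le)

lemma lower_central_end:
  assumes "lower_central d \<subseteq> annihilator (2 * n - 2)"
  shows "lower_central (Suc d) = {0}"
proof -
  have "e (2 * n) \<cdot> e 2 = 0" using mult_skew[of "e (2 * n)" "e 2"] e_2_mult by simp
  moreover have "2 * n - 2 + 2 = 2 * n" "2 * n - (2 * n - 2) = 2" using n_ge by linarith+
  ultimately have "lower_central (Suc d) \<subseteq> {0}"
    using lower_central_skip[OF assms] annihilator_top by simp
  then show ?thesis using subspace_0[OF subspace_lower_central, of "Suc d"] by auto
qed

lemma lower_central_eq_0:
  assumes "lower_central d \<subseteq> annihilator t" "t \<le> 2 * n - 2"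
  shows "lower_central (d + (2 * n - 2 - t) + 1) = {0}"
  using lower_central_end[of "d + (2 * n - 2 - t)"]
    lower_central_steps[OF assms(1), of "2 * n - 2 - t"] assms(2) n_ge by simp

text \<open>From index \<open>t\<close> to \<open>2 * n\<close> there are \<open>2 * n - t\<close>
  single steps; the free double steps in the middle and at the end save one each.\<close>

lemma lower_central_eq_0_through_middle:
  assumes "lower_central d \<subseteq> annihilator t" "t \<le> n - 1"
  shows "lower_central (d + (2 * n - 3 - t) + 1) = {0}"
proof -
  define d' where "d' = d + (n - 1 - t)"
  have "lower_central d' \<subseteq> annihilator (n - 1)"
    using lower_central_steps[OF assms(1), of "n - 1 - t"] assms(2) n_ge by (simp add: d'_def)
  from lower_central_eq_0[OF lower_central_middle[OF this]]
  have "lower_central (Suc d' + (2 * n - 2 - (n + 1)) + 1) = {0}" using n_ge by simp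
  moreover have "Suc d' + (2 * n - 2 - (n + 1)) + 1 = d + (2 * n - 3 - t) + 1"
    unfolding d'_def using assms(2) n_ge by linarith
  ultimately show ?thesis by metis
qed

text \<open>Three free double steps, at the start, in the middle and at the end, reduce
  \<open>2 * n\<close> to \<open>2 * n - 3\<close>.\<close>

lemma lower_central_class_le: "lower_central (2 * n - 3) = {0}"
proof -
  have "1 + (2 * n - 3 - 2) + 1 = 2 * n - 3" "2 \<le> n - 1" using n_ge by linarith+
  then show ?thesis using lower_central_eq_0_through_middle[OF lower_central_1] by metis
qed

section \<open>A failing condition lowers the class\<close>

lemma form_e_3_nonzero:
  assumes "e 3 \<cdot> e (2 * n - 1) \<noteq> 0"
  shows "form (e 3 \<cdot> e (2 * n - 1)) (e (2 * n)) \<noteq> 0"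
proof -
  from assms obtain q where q: "q \<in> {1..2 * n}" "form (e 3 \<cdot> e (2 * n - 1)) (e q) \<noteq> 0"
    using eq_0_if_orthogonal by blast
  moreover have "3 \<in> {1..2 * n}" "2 * n - 1 \<in> {1..2 * n}" using n_ge by auto
  \<comment> \<open>Only \<open>2 * n - 1\<close> and \<open>2 * n\<close> meet the index bound, and
    the former repeats a factor.\<close>
  ultimately have "3 + q > 2 * n + 1" "q \<noteq> 2 * n - 1" using triple_nonzeroD by blast+
  then have "q = 2 * n" using q by auto
  then show "form (e 3 \<cdot> e (2 * n - 1)) (e (2 * n)) \<noteq> 0" using q by simp
qed

lemma form_e_3_swap: "form (e 3 \<cdot> e (2 * n)) (e (2 * n - 1)) = - form (e 3 \<cdot> e (2 * n - 1)) (e (2 * n))"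
proof -
  have "form (e 3 \<cdot> e (2 * n)) (e (2 * n - 1)) = form (e (2 * n - 1) \<cdot> e 3) (e (2 * n))"
    by (metis form_mult_cyclic)
  also have "\<dots> = - form (e 3 \<cdot> e (2 * n - 1)) (e (2 * n))"
    using mult_skew[of "e (2 * n - 1)" "e 3"] form_scale_left[of "- 1" "e 3 \<cdot> e (2 * n - 1)"] by simp
  finally show ?thesis .
qed

text \<open>The vanishing product decides the double step from index \<open>k - 2\<close> to
  \<open>k\<close>, so one more step is saved. For \<open>k = 3\<close> that double step would start
  at index 1, which the series has already jumped over; there the first term must be shown to drop
  straight to index 3.\<close>

lemma class_small_if_product_zero:
  assumes k: "3 \<le> k" "k \<le> n - 1" and zero: "e k \<cdot> e (2 * n + 2 - k) = 0"
  shows "lower_central (2 * n - 4) = {0}"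
proof -
  have "lower_central (k - 2) \<subseteq> annihilator k"
  proof (cases "k = 3")
    case True
    have zero': "e 3 \<cdot> e (2 * n - 1) = 0" using zero True by simp
    \<comment> \<open>Up to sign, the products of \<open>e 3\<close> with \<open>e (2 * n)\<close>
      and with \<open>e (2 * n - 1)\<close> are governed by the same triple value, so they vanish
      together.\<close>
    have zero'': "e 3 \<cdot> e (2 * n) = 0"
    proof (rule eq_0_if_orthogonal, rule ccontr)
      fix q assume q: "q \<in> {1..2 * n}" "form (e 3 \<cdot> e (2 * n)) (e q) \<noteq> 0"
      moreover have "3 \<in> {1..2 * n}" "2 * n \<in> {1..2 * n}" using n_ge by auto
      ultimately have "3 + q > 2 * n + 1" "q \<noteq> 2 * n" using triple_nonzeroD by blast+
      then have "q = 2 * n - 1" using q by auto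
      then show False using q form_e_3_swap zero' by simp
    qed
    have "lower_central (Suc 0) \<subseteq> annihilator 3"
    proof (subst lower_central_Suc_subset_iff, goal_cases)
      case 2
      show ?case
      proof (intro ballI)
        fix u and k :: nat assume "k \<in> {1..3}"
        obtain c w where u: "u = scale c (e (2 * n)) + w" and w: "w \<in> annihilator 1"
          using annihilator_leading[of u 0] n_ge by auto
        obtain d z where wz: "w = scale d (e (2 * n - 1)) + z" and z: "z \<in> annihilator 2"
          using annihilator_leading[OF w] n_ge by (auto simp: numeral_2_eq_2)
        have "e k \<cdot> z = 0" by (rule e_mult_annihilator[OF z]) (use \<open>k \<in> {1..3}\<close> n_ge in auto)
        moreover have "e k \<cdot> e (2 * n - 1) = 0"
          using \<open>k \<in> {1..3}\<close> zero' e_mult_e_eq_0[of k "2 * n - 1"] n_ge by (cases "k = 3") auto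
        moreover consider "k = 1" | "k = 2" | "k = 3" using \<open>k \<in> {1..3}\<close> by force
        then have "e k \<cdot> e (2 * n) = 0"
          by cases (use zero'' e_2_mult e_mult_e_eq_0[of 1 "2 * n"] n_ge in auto)
        ultimately show "e k \<cdot> u = 0" by (simp add: u wz mult_add_right mult_scale_right)
      qed
    qed (use n_ge in simp)
    then show ?thesis using True by simp
  next
    case False
    then have "k = (k - 4) + 4" using k by linarith
    then obtain j where j: "k = j + 4" by blast
    have "lower_central (j + 1) \<subseteq> annihilator (j + 2)"
      using lower_central_upper[of "j + 1"] k j by (simp add: numeral_eq_Suc)
    from lower_central_skip[OF this] show ?thesis using zero k j by (simp add: numeral_eq_Suc)
  qed
  from lower_central_eq_0_through_middle[OF this k(2)]
  have "lower_central (k - 2 + (2 * n - 3 - k) + 1) = {0}" .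
  moreover have "k - 2 + (2 * n - 3 - k) + 1 = 2 * n - 4" using k n_ge by linarith
  ultimately show ?thesis by metis
qed

text \<open>Peels off both middle vectors at once, since the series passes over index
  \<open>n\<close>.\<close>

lemma annihilator_middle:
  assumes "u \<in> annihilator (n - 1)"
  obtains c d w where "u = scale c (e n) + scale d (e (n + 1)) + w" "w \<in> annihilator (n + 1)"
proof -
  have "n - 1 < 2 * n" "2 * n - (n - 1) = n + 1" "Suc (n - 1) = n" "n < 2 * n" "2 * n - n = n"
    using n_ge by auto
  then obtain d v where v: "u = scale d (e (n + 1)) + v" "v \<in> annihilator n"
    using annihilator_leading[OF assms] by metis
  obtain c w where "v = scale c (e n) + w" "w \<in> annihilator (Suc n)"
    using annihilator_leading[OF v(2)] \<open>n < 2 * n\<close> \<open>2 * n - n = n\<close> by metis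
  then show ?thesis using v that[of c d w] by (simp add: algebra_simps)
qed

text \<open>
  The middle terms \<open>A\<^bsub>n-1\<^esub>, A\<^bsub>n+1\<^esub>\<close> of the chain are replaced by the single space of those
  \<open>u \<in> A\<^bsub>n-1\<^esub>\<close> that are orthogonal to \<open>w = a e\<^sub>n + b e\<^bsub>n+1\<^esub>\<close>; it is its own orthogonal complement.
\<close>

lemma class_small_if_middle_dependent:
  assumes dep: "scale a (e n \<cdot> e (n + 2)) + scale b (e (n + 1) \<cdot> e (n + 2)) = 0"
    and ab: "a \<noteq> 0 \<or> b \<noteq> 0"
  shows "lower_central (2 * n - 4) = {0}"
proof -
  \<comment> \<open>The assumed dependence says exactly that \<open>w\<close> annihilates
    \<open>e (n + 2)\<close>.\<close>
  define w where "w = scale a (e n) + scale b (e (n + 1))"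
  define W where "W = annihilator (n - 1) \<inter> {u. form u w = 0}"
  have W: "subspace W"
    unfolding W_def using subspace_annihilator[of "n - 1"]
    by (auto simp: subspace_def form_add_left form_scale_left)
  have dep': "e (n + 2) \<cdot> w = 0"
    using dep mult_skew[of "e (n + 2)" w]
    by (simp add: w_def mult_add_left mult_scale_left)
  have low: "lower_central (n - 3) \<subseteq> annihilator (n - 2)"
    using lower_central_upper[of "n - 3"] n_ge by (simp add: numeral_eq_Suc Suc_diff_Suc)
  \<comment> \<open>Since \<open>(u v, w) = (w u, v)\<close>, this makes all products from the
    current term orthogonal to \<open>w\<close> and so puts the next term into
    \<open>W\<close>.\<close>
  have w_mult: "u \<cdot> w = 0" if u: "u \<in> annihilator (n - 2)" for u
  proof -
    have "n - 2 < 2 * n" "2 * n - (n - 2) = n + 2" "Suc (n - 2) = n - 1" using n_ge by auto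
    then obtain c v where v: "u = scale c (e (n + 2)) + v" "v \<in> annihilator (n - 1)"
      using annihilator_leading[OF u] by metis
    from annihilator_middle[OF v(2)]
    obtain c' d z where z: "v = scale c' (e n) + scale d (e (n + 1)) + z" "z \<in> annihilator (n + 1)" .
    have "z \<in> annihilator n" using z(2) annihilator_antimono[of n "n + 1"] by auto
    then have "z \<cdot> e n = 0" "z \<cdot> e (n + 1) = 0"
      using e_mult_annihilator[of z n] mult_skew[of z] n_ge by auto
    moreover have "e n \<cdot> e (n + 1) = 0" "e (n + 1) \<cdot> e n = 0"
      using n_ge by (auto intro!: e_mult_e_eq_0)
    ultimately have "v \<cdot> w = 0"
      by (simp add: z w_def mult_add_left mult_add_right mult_scale_left mult_scale_right mult_alternating)
    then show ?thesis using dep' by (simp add: v mult_add_left mult_scale_left)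
  qed
  have "lower_central (Suc (n - 3)) \<subseteq> annihilator (Suc (n - 2))"
    using lower_central_step[OF low] n_ge by auto
  moreover have "form (u \<cdot> v) w = 0" if "u \<in> lower_central (n - 3)" for u v
  proof -
    have "form (u \<cdot> v) w = form (w \<cdot> u) v" by (metis form_mult_cyclic)
    also have "w \<cdot> u = 0" using w_mult[of u] mult_skew[of w u] low that by auto
    finally show ?thesis by simp
  qed
  then have "\<forall>u\<in>lower_central (n - 3). \<forall>v. u \<cdot> v \<in> {u. form u w = 0}" by auto
  then have "lower_central (Suc (n - 3)) \<subseteq> {u. form u w = 0}"
    by (subst lower_central.simps, subst subspace_prod_subset_iff)
      (auto simp: subspace_def form_add_left form_scale_left)
  ultimately have "lower_central (Suc (n - 3)) \<subseteq> W"
    using n_ge by (auto simp: W_def numeral_eq_Suc Suc_diff_Suc)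
  \<comment> \<open>This sends \<open>W\<close> to index \<open>n + 2\<close> in one step. Going
    from \<open>n - 2\<close> to \<open>n + 2\<close> thus takes two steps instead of the three
    through \<open>n - 1\<close> and \<open>n + 1\<close>.\<close>
  moreover have "e k \<cdot> u = 0" if "u \<in> W" "k \<in> {1..n + 2}" for u k
  proof -
    have u: "u \<in> annihilator (n - 1)" and uw: "form u w = 0" using that by (auto simp: W_def)
    from annihilator_middle[OF u]
    obtain c d z where z: "u = scale c (e n) + scale d (e (n + 1)) + z" "z \<in> annihilator (n + 1)" .
    have ekz: "e k \<cdot> z = 0" using e_mult_annihilator[OF z(2)] that n_ge by auto
    show ?thesis
    proof (cases "k = n + 2")
      case True
      have "form z (e n) = 0" "form z (e (n + 1)) = 0"
        using z(2) n_ge by (auto simp: annihilator_def)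
      \<comment> \<open>Orthogonality to \<open>w\<close> makes \<open>(c, d)\<close> proportional
        to \<open>(a, b)\<close>, so modulo \<open>z\<close> the vector \<open>u\<close> is a
        multiple of \<open>w\<close>.\<close>
      then have "c * b * form (e n) (e (n + 1)) = d * a * form (e n) (e (n + 1))"
        using uw form_skew[of "e (n + 1)" "e n"]
        by (simp add: z w_def form_add_left form_add_right form_scale_left form_scale_right
            form_alternating mult.commute)
      moreover have "form (e n) (e (n + 1)) \<noteq> 0" using n_ge by (simp add: form_e_eq_0_iff)
      ultimately have cd: "c * b = d * a" by simp
      have E: "scale a (e k \<cdot> e n) + scale b (e k \<cdot> e (n + 1)) = 0"
        using dep' True by (simp add: w_def mult_add_right mult_scale_right)
      have "e k \<cdot> u = scale c (e k \<cdot> e n) + scale d (e k \<cdot> e (n + 1))"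
        using ekz by (simp add: z mult_add_right mult_scale_right)
      \<comment> \<open>Multiplying by \<open>a\<close> and by \<open>b\<close> separately avoids
        choosing which of them is nonzero.\<close>
      moreover have "scale a (scale c (e k \<cdot> e n) + scale d (e k \<cdot> e (n + 1)))
          = scale c (scale a (e k \<cdot> e n) + scale b (e k \<cdot> e (n + 1)))"
        using cd by (simp add: scale_right_distrib mult.commute)
      moreover have "scale b (scale c (e k \<cdot> e n) + scale d (e k \<cdot> e (n + 1)))
          = scale d (scale a (e k \<cdot> e n) + scale b (e k \<cdot> e (n + 1)))"
        using cd by (simp add: scale_right_distrib mult.commute)
      ultimately show ?thesis using E ab by auto
    next
      case False
      then have "e k \<cdot> e n = 0" "e k \<cdot> e (n + 1) = 0"
        using that n_ge mult_alternating e_mult_e_eq_0[of k n] e_mult_e_eq_0[of k "n + 1"]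
        by (cases "k = n + 1"; auto)+
      then show ?thesis using ekz by (simp add: z mult_add_right mult_scale_right)
    qed
  qed
  ultimately have "lower_central (Suc (Suc (n - 3))) \<subseteq> annihilator (n + 2)"
    using n_ge by (subst lower_central_Suc_subset_iff) auto
  from lower_central_eq_0[OF this]
  have "lower_central (Suc (Suc (n - 3)) + (2 * n - 2 - (n + 2)) + 1) = {0}" using n_ge by auto
  moreover have "Suc (Suc (n - 3)) + (2 * n - 2 - (n + 2)) + 1 = 2 * n - 4" using n_ge by linarith
  ultimately show ?thesis by metis
qed

section \<open>The conditions force class \<open>2 * n - 3\<close>\<close>

context
  assumes product_nonzero: "\<And>k. k \<in> {3..n - 1} \<Longrightarrow> e k \<cdot> e (2 * n + 2 - k) \<noteq> 0"
    and middle_independent: "\<And>a b. scale a (e n \<cdot> e (n + 2)) + scale b (e (n + 1) \<cdot> e (n + 2)) = 0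
      \<Longrightarrow> a = 0 \<and> b = 0"
begin

text \<open>These products decide the double steps from index \<open>j - 1\<close>. The hypotheses
  cover one half of the flag, and skew symmetry reflects them to the other. At \<open>j = n\<close>
  the product is a square.\<close>

lemma product_nonzero_symmetric:
  assumes "j \<in> {2..2 * n - 2}" "j \<noteq> n" "j \<noteq> n + 1"
  shows "e (j + 1) \<cdot> e (2 * n + 1 - j) \<noteq> 0"
proof -
  consider "j + 1 \<in> {3..n - 1}" | "j + 1 = n" | "2 * n + 1 - j \<in> {3..n - 1}"
    using assms by fastforce
  then show ?thesis
  proof cases
    case 1
    then show ?thesis using product_nonzero[OF 1] by simp
  next
    case 2
    moreover from this have "2 * n + 1 - j = n + 2" by simp
    ultimately show ?thesis using middle_independent[of 1 0] by auto
  next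
    case 3
    then have "2 * n + 2 - (2 * n + 1 - j) = j + 1" by auto
    then show ?thesis
      using product_nonzero[OF 3] mult_skew[of "e (j + 1)" "e (2 * n + 1 - j)"] by auto
  qed
qed

lemma centralizer_3:
  assumes "e 3 \<cdot> u = 0"
  shows "u \<in> annihilator 2"
proof -
  let ?f = "form (e 3 \<cdot> e (2 * n - 1)) (e (2 * n))"
  have f: "?f \<noteq> 0" using product_nonzero[of 3] form_e_3_nonzero n_ge by simp
  obtain c w where u: "u = scale c (e (2 * n)) + w" and w: "w \<in> annihilator 1"
    using annihilator_leading[of u 0] n_ge by auto
  obtain d z where wz: "w = scale d (e (2 * n - 1)) + z" and z: "z \<in> annihilator 2"
    using annihilator_leading[OF w] n_ge by (auto simp: numeral_2_eq_2)
  have "e 3 \<cdot> z = 0" by (rule e_mult_annihilator[OF z]) (use n_ge in auto)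
  then have eq: "scale c (e 3 \<cdot> e (2 * n)) + scale d (e 3 \<cdot> e (2 * n - 1)) = 0"
    using assms by (simp add: u wz mult_add_right mult_scale_right)
  have alt: "form (p \<cdot> q) q = 0" for p q
    using form_mult_cyclic[of p q q] mult_alternating[of q] by simp
  \<comment> \<open>Each of the two pairings kills one summand, by alternation, and leaves the other
    coefficient times the nonzero triple value up to sign.\<close>
  have "form (scale c (e 3 \<cdot> e (2 * n)) + scale d (e 3 \<cdot> e (2 * n - 1))) (e (2 * n)) = 0"
    "form (scale c (e 3 \<cdot> e (2 * n)) + scale d (e 3 \<cdot> e (2 * n - 1))) (e (2 * n - 1)) = 0"
    by (simp_all only: eq form_zero_left)
  then have "c = 0" "d = 0"
    using f form_e_3_swap by (simp_all add: form_add_left form_scale_left alt)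
  then show ?thesis using z by (simp add: u wz)
qed

text \<open>A converse to \<open>e_mult_annihilator\<close>: with nonzero deciding products, each
  further annihilated \<open>e k\<close> removes a leading coefficient. It fails at
  \<open>r = n + 1\<close>, where \<open>e (n + 1)\<close> annihilates
  \<open>e 1, ..., e (n + 1)\<close> but pairs nontrivially with \<open>e n\<close>.\<close>

lemma centralizer_subset_annihilator:
  assumes "3 \<le> r" "r \<le> 2 * n - 1" "r \<noteq> n + 1" "\<And>k. k \<in> {1..r} \<Longrightarrow> e k \<cdot> u = 0"
  shows "u \<in> annihilator (r - 1)"
  using assms
proof (induction r rule: less_induct)
  case (less r)
  consider "r = 3" | "r = n + 2" | "r > 3" "r \<noteq> n + 2" using less.prems by linarith
  then show ?case
  proof cases
    case 1
    then show ?thesis using centralizer_3[of u] less.prems by auto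
  next
    case 2
    \<comment> \<open>The induction has to jump over \<open>n + 1\<close>, so two middle
      coefficients remain; independence removes both together.\<close>
    have "u \<in> annihilator (n - 1)" using less.IH[of n] less.prems 2 n_ge by auto
    from annihilator_middle[OF this]
    obtain c d z where z: "u = scale c (e n) + scale d (e (n + 1)) + z" "z \<in> annihilator (n + 1)" .
    have "e (n + 2) \<cdot> z = 0" using e_mult_annihilator[OF z(2)] n_ge by auto
    moreover have "e (n + 2) \<cdot> u = 0" using less.prems 2 by auto
    ultimately have "scale c (e (n + 2) \<cdot> e n) + scale d (e (n + 2) \<cdot> e (n + 1)) = 0"
      by (simp add: z mult_add_right mult_scale_right)
    then have "scale (- c) (e n \<cdot> e (n + 2)) + scale (- d) (e (n + 1) \<cdot> e (n + 2)) = 0"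
      using mult_skew[of "e (n + 2)"] by simp
    then have "c = 0 \<and> d = 0" using middle_independent[of "- c" "- d"] by simp
    then show ?thesis using z 2 by simp
  next
    case 3
    define j where "j = r - 1"
    have j: "j \<in> {2..2 * n - 2}" "j \<noteq> n" "j \<noteq> n + 1" "r = j + 1" "3 \<le> j"
      using 3 less.prems by (auto simp: j_def)
    have "u \<in> annihilator (j - 1)"
      using less.IH[of j] less.prems j by auto
    moreover have idx: "j - 1 < 2 * n" "2 * n - (j - 1) = 2 * n + 1 - j" "Suc (j - 1) = j"
      using j by auto
    ultimately obtain c w where u: "u = scale c (e (2 * n + 1 - j)) + w" "w \<in> annihilator j"
      "c = 0 \<Longrightarrow> u \<in> annihilator j"
      using annihilator_leading[of u "j - 1"] by metis
    have "e (j + 1) \<cdot> w = 0" by (rule e_mult_annihilator[OF u(2)]) (use j in auto)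
    moreover have "e (j + 1) \<cdot> u = 0" using less.prems j by auto
    ultimately have "scale c (e (j + 1) \<cdot> e (2 * n + 1 - j)) = 0"
      by (simp add: u(1) mult_add_right mult_scale_right)
    then have "c = 0" using product_nonzero_symmetric j by simp
    then show ?thesis using u j by simp
  qed
qed

text \<open>Climbs back up the series: a term that is too small forces its predecessor to be too
  small.\<close>

lemma lower_central_ascend:
  assumes "3 \<le> r" "r \<le> 2 * n - 1" "r \<noteq> n + 1" "lower_central (Suc d) \<subseteq> annihilator r"
  shows "lower_central d \<subseteq> annihilator (r - 1)"
proof
  fix u assume u: "u \<in> lower_central d"
  have "r \<le> 2 * n" using assms by simp
  from iffD1[OF lower_central_Suc_subset_iff[OF this] assms(4)] u
  show "u \<in> annihilator (r - 1)" by (intro centralizer_subset_annihilator assms) auto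
qed

text \<open>Climbing back would put the whole algebra into index 2, but \<open>e (2 * n)\<close>
  pairs with \<open>e 1\<close>.\<close>

lemma lower_central_lower_half:
  assumes "d \<le> n - 3"
  shows "\<not> lower_central d \<subseteq> annihilator (d + 2)"
  using assms
proof (induction d)
  case 0
  have "e (2 * n) \<notin> annihilator 2" using n_ge by (auto simp: annihilator_def form_e_eq_0_iff)
  then show ?case by (auto simp: numeral_2_eq_2)
next
  case (Suc d)
  then have "3 \<le> Suc d + 2" "Suc d + 2 \<le> 2 * n - 1" "Suc d + 2 \<noteq> n + 1" "Suc d + 2 - 1 = d + 2"
    using n_ge by linarith+
  then show ?case using lower_central_ascend[of "Suc d + 2" d] Suc by (metis Suc_leD)
qed

lemma lower_central_upper_half:
  assumes "j \<le> n - 3"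
  shows "\<not> lower_central (n - 2 + j) \<subseteq> annihilator (n + 1 + j)"
  using assms
proof (induction j)
  case 0
  have *: "n - 2 = Suc (n - 3)" using n_ge by simp
  show ?case
  proof
    assume "lower_central (n - 2 + 0) \<subseteq> annihilator (n + 1 + 0)"
    \<comment> \<open>Climbing from index \<open>n + 1\<close> is not possible, so the inclusion is
      first weakened to index \<open>n\<close>. This matches the free double step in the
      middle.\<close>
    then have "lower_central (Suc (n - 3)) \<subseteq> annihilator n"
      using annihilator_antimono[of n "n + 1"] * by auto
    from lower_central_ascend[OF _ _ _ this] have "lower_central (n - 3) \<subseteq> annihilator (n - 1)"
      using n_ge by auto
    moreover have "n - 3 + 2 = n - 1" using n_ge by simp
    ultimately show False using lower_central_lower_half[of "n - 3"] by auto
  qed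
next
  case (Suc j)
  then have "3 \<le> n + 1 + Suc j" "n + 1 + Suc j \<le> 2 * n - 1" "n + 1 + Suc j \<noteq> n + 1"
    "n + 1 + Suc j - 1 = n + 1 + j" "n - 2 + Suc j = Suc (n - 2 + j)"
    using n_ge by linarith+
  then show ?case
    using lower_central_ascend[of "n + 1 + Suc j" "n - 2 + j"] Suc by (metis Suc_leD)
qed

lemma lower_central_class_ge: "lower_central (2 * n - 4) \<noteq> {0}"
proof
  assume *: "lower_central (2 * n - 4) = {0}"
  have "2 * n - 4 = Suc (n - 2 + (n - 3))" using n_ge by auto
  \<comment> \<open>The zero space has index \<open>2 * n\<close>; weakening to
    \<open>2 * n - 1\<close> reaches the range of \<open>lower_central_ascend\<close> and matches
    the free double step at the end.\<close>
  then have "lower_central (Suc (n - 2 + (n - 3))) \<subseteq> annihilator (2 * n - 1)"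
    using * subspace_0[OF subspace_annihilator] by auto
  from lower_central_ascend[OF _ _ _ this]
  have "lower_central (n - 2 + (n - 3)) \<subseteq> annihilator (2 * n - 1 - 1)" using n_ge by auto
  moreover have "2 * n - 1 - 1 = n + 1 + (n - 3)" using n_ge by auto
  ultimately show False using lower_central_upper_half[of "n - 3"] by auto
qed

end

section \<open>The class criterion for a flag basis\<close>

lemma least_lower_central_iff:
  "(LEAST m. lower_central m = {0}) = 2 * n - 3 \<longleftrightarrow> lower_central (2 * n - 4) \<noteq> {0}"
proof
  assume eq: "(LEAST m. lower_central m = {0}) = 2 * n - 3"
  have "2 * n - 4 < (LEAST m. lower_central m = {0})" unfolding eq using n_ge by auto
  then show "lower_central (2 * n - 4) \<noteq> {0}" by (rule not_less_Least)
next
  assume ne: "lower_central (2 * n - 4) \<noteq> {0}"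
  show "(LEAST m. lower_central m = {0}) = 2 * n - 3"
  proof (rule Least_equality)
    show "lower_central (2 * n - 3) = {0}" by (rule lower_central_class_le)
    fix m assume m: "lower_central m = {0}"
    show "2 * n - 3 \<le> m"
    proof (rule ccontr)
      assume "\<not> 2 * n - 3 \<le> m"
      then have "lower_central (2 * n - 4) \<subseteq> {0}"
        using lower_central_antimono[of m "2 * n - 4"] m by auto
      then show False using ne subspace_0[OF subspace_lower_central, of "2 * n - 4"] by auto
    qed
  qed
qed

lemma class_eq_iff:
  "nilpotence_class = 2 * n - 3 \<longleftrightarrow>
    (\<forall>k\<in>{3..n - 1}. e k \<cdot> e (2 * n + 2 - k) \<noteq> 0) \<and>
    lin_independent_pair (e n \<cdot> e (n + 2)) (e (n + 1) \<cdot> e (n + 2))"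
  unfolding nilpotence_class_eq least_lower_central_iff lin_independent_pair_iff
  using lower_central_class_ge class_small_if_product_zero class_small_if_middle_dependent
  by (meson atLeastAtMost_iff)

end

section \<open>From the nilpotent presentation to a flag basis\<close>

theorem theorem3p4:
  fixes scale :: "'a::field \<Rightarrow> 'b::ab_group_add \<Rightarrow> 'b"
    and form :: "'b \<Rightarrow> 'b \<Rightarrow> 'a"
    and mult :: "'b \<Rightarrow> 'b \<Rightarrow> 'b"  (infixl "\<cdot>" 70)
    and n :: nat
    and x y :: "nat \<Rightarrow> 'b"
    and \<alpha> \<beta> :: "nat \<Rightarrow> nat \<Rightarrow> nat \<Rightarrow> 'a"
  assumes "symplectic_alternating_algebra scale form mult"
    and "symplectic_alternating_algebra.nilpotent scale mult"
    and "vector_space.dim scale UNIV = 2 * n"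
    and "2 * n \<ge> 8"
    and "symplectic_alternating_algebra.nilpotent_presentation scale form mult n x y \<alpha> \<beta>"
  shows "symplectic_alternating_algebra.maximal_class scale mult \<longleftrightarrow>
    (\<forall>i\<in>{2..n - 2}. x i \<cdot> y (i + 1) \<noteq> 0) \<and>
    symplectic_alternating_algebra.lin_independent_pair scale (x 1 \<cdot> y 2) (y 1 \<cdot> y 2)"
proof -
  interpret symplectic_alternating_algebra scale form mult by fact
  define e where "e t = (if t \<le> n then x (n + 1 - t) else y (t - n))" for t
  let ?B = "x ` {1..n} \<union> y ` {1..n}"
  have n: "n \<ge> 4" using assms(4) by simp
  have x_e: "x i = e (n + 1 - i)" if "1 \<le> i" "i \<le> n" for i using that by (auto simp: e_def)
  have y_e: "y i = e (n + i)" if "1 \<le> i" for i using that by (simp add: e_def)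
  have e_in: "e t \<in> ?B" if "t \<in> {1..2 * n}" for t
  proof -
    have "n + 1 - t \<in> {1..n}" if "t \<le> n" using that \<open>t \<in> {1..2 * n}\<close> by auto
    moreover have "t - n \<in> {1..n}" if "\<not> t \<le> n" using that \<open>t \<in> {1..2 * n}\<close> by auto
    ultimately show ?thesis by (simp add: e_def)
  qed
  have B_e: "?B = e ` {1..2 * n}"
  proof
    show "?B \<subseteq> e ` {1..2 * n}" by (auto simp: x_e y_e intro!: imageI)
    show "e ` {1..2 * n} \<subseteq> ?B" using e_in by (rule image_subsetI)
  qed
  have std: "standard_basis n x y"
    and van: "\<And>u v w. u \<in> ?B \<Longrightarrow> v \<in> ?B \<Longrightarrow> w \<in> ?B \<Longrightarrow> form (u \<cdot> v) w \<noteq> 0 \<Longrightarrow>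
      \<exists>i j k. 1 \<le> i \<and> i < j \<and> j < k \<and> k \<le> n \<and>
           ({#u, v, w#} = {#x i, y j, y k#} \<or> {#u, v, w#} = {#y i, y j, y k#})"
    using assms(5) unfolding nilpotent_presentation_def by blast+
  have fe: "form (e p) (e q) = 0 \<longleftrightarrow> p + q \<noteq> 2 * n + 1"
    if "p \<in> {1..2 * n}" "q \<in> {1..2 * n}" for p q
  proof -
    have pairing: "form (x i) (x j) = 0" "form (y i) (y j) = 0"
      "form (x i) (y j) = (if i = j then 1 else 0)" "form (y i) (x j) = (if i = j then - 1 else 0)"
      if "i \<in> {1..n}" "j \<in> {1..n}" for i j
      using std that form_skew[of "y i" "x j"] by (auto simp: standard_basis_def)
    have x_index: "n + 1 - t \<in> {1..n}" if "t \<in> {1..2 * n}" "t \<le> n" for t using that by auto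
    have y_index: "t - n \<in> {1..n}" if "t \<in> {1..2 * n}" "\<not> t \<le> n" for t using that by auto
    consider "p \<le> n" "q \<le> n" | "p \<le> n" "\<not> q \<le> n" | "\<not> p \<le> n" "q \<le> n" | "\<not> p \<le> n" "\<not> q \<le> n"
      by blast
    then show ?thesis
    proof cases
      case 1
      then show ?thesis using pairing(1)[OF x_index x_index] that by (auto simp: e_def)
    next
      case 2
      then have "n + 1 - p = q - n \<longleftrightarrow> p + q = 2 * n + 1" using that by auto
      then show ?thesis using pairing(3)[OF x_index y_index] that 2 by (simp add: e_def)
    next
      case 3
      then have "p - n = n + 1 - q \<longleftrightarrow> p + q = 2 * n + 1" using that by auto
      then show ?thesis using pairing(4)[OF y_index x_index] that 3 by (simp add: e_def)
    next
      case 4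
      then show ?thesis using pairing(2)[OF y_index y_index] that by (auto simp: e_def)
    qed
  qed
  \<comment> \<open>Distinct indices are told apart by the pairing with
    \<open>e (2 * n + 1 - q)\<close>. This turns equality of multisets of vectors into information
    on indices.\<close>
  have inj: "p = q" if "p \<in> {1..2 * n}" "q \<in> {1..2 * n}" "e p = e q" for p q
  proof -
    have "2 * n + 1 - q \<in> {1..2 * n}" using that by auto
    then show ?thesis using fe[of p "2 * n + 1 - q"] fe[of q "2 * n + 1 - q"] that by auto
  qed
  have triple: "form (e p \<cdot> e q) (e r) = 0"
    if pqr: "p \<in> {1..2 * n}" "q \<in> {1..2 * n}" "r \<in> {1..2 * n}" and le: "p + q \<le> 2 * n + 1" for p q r
  proof (rule ccontr)
    assume nz: "form (e p \<cdot> e q) (e r) \<noteq> 0"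
    then have "p \<noteq> q" using mult_alternating by auto
    \<comment> \<open>In a listed triple any two indices sum to more than \<open>2 * n + 1\<close>:
      \<open>x i\<close> has index \<open>n + 1 - i\<close>, and
      \<open>(n + 1 - i) + (n + j)\<close> exceeds the bound because \<open>i < j\<close>. The
      distinct \<open>p\<close> and \<open>q\<close> are two of these indices.\<close>
    obtain a b c where abc: "a \<in> {1..2 * n}" "b \<in> {1..2 * n}" "c \<in> {1..2 * n}"
      "a + b > 2 * n + 1" "b + c > 2 * n + 1" "a + c > 2 * n + 1"
      and ms: "{#e p, e q, e r#} = {#e a, e b, e c#}"
    proof -
      from van[OF e_in[OF pqr(1)] e_in[OF pqr(2)] e_in[OF pqr(3)] nz]
      obtain i j k where ijk: "1 \<le> i" "i < j" "j < k" "k \<le> n"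
        and "{#e p, e q, e r#} = {#x i, y j, y k#} \<or> {#e p, e q, e r#} = {#y i, y j, y k#}"
        by blast
      then consider "{#e p, e q, e r#} = {#e (n + 1 - i), e (n + j), e (n + k)#}"
        | "{#e p, e q, e r#} = {#e (n + i), e (n + j), e (n + k)#}"
        by (auto simp: x_e y_e)
      then show thesis
        by cases (rule that[rotated -1], assumption, use ijk in auto)+
    qed
    have "e p \<in> {e a, e b, e c}" "e q \<in> {e a, e b, e c}"
      using arg_cong[OF ms, of set_mset] by auto
    then have "p \<in> {a, b, c}" "q \<in> {a, b, c}" using inj abc pqr by auto
    then show False using \<open>p \<noteq> q\<close> abc le by auto
  qed
  interpret flag_basis scale form mult n e
    by unfold_locales (use n std B_e fe triple in \<open>auto simp: standard_basis_def\<close>)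
  have "maximal_class \<longleftrightarrow> nilpotence_class = 2 * n - 3"
    using assms(2,3) by (simp add: maximal_class_def)
  moreover have "(\<forall>i\<in>{2..n - 2}. x i \<cdot> y (i + 1) \<noteq> 0) \<longleftrightarrow>
      (\<forall>k\<in>{3..n - 1}. e k \<cdot> e (2 * n + 2 - k) \<noteq> 0)"
  proof -
    \<comment> \<open>With \<open>k = n + 1 - i\<close>, the vector \<open>e k\<close> is
      \<open>x i\<close> and its cofactor has index \<open>n + (i + 1)\<close>, which is
      \<open>y (i + 1)\<close>.\<close>
    have img: "{3..n - 1} = (\<lambda>i. n + 1 - i) ` {2..n - 2}"
    proof
      show "{3..n - 1} \<subseteq> (\<lambda>i. n + 1 - i) ` {2..n - 2}"
        by (rule subsetI, rule_tac x = "n + 1 - x" in image_eqI) auto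
    qed auto
    have "e (n + 1 - i) \<cdot> e (2 * n + 2 - (n + 1 - i)) = x i \<cdot> y (i + 1)" if "i \<in> {2..n - 2}" for i
    proof -
      have "2 * n + 2 - (n + 1 - i) = n + (i + 1)" using that by auto
      then show ?thesis using that x_e[of i] y_e[of "i + 1"] by auto
    qed
    then show ?thesis unfolding img by auto
  qed
  moreover have "x 1 = e n" "y 1 = e (n + 1)" "y 2 = e (n + 2)"
    using n by (auto simp: e_def)
  ultimately show ?thesis using class_eq_iff by simp
qed

end
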